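(* Let $\alpha\ge 1$ be a real number. Let $\{f_n\}_n$ be a sequence of meromorphic functions in a domain $D\subseteq\mathbb{C}$ and let some $z_0\in D$ be given. Assume that there exist sequences $\{z_n\}_n$ and $\{p_n\}_n$ in $D$ such that $\lim_{n\to\infty} z_n=\lim_{n\to\infty} p_n=z_0$ and $f_n(z_n)=0$, $f_n(p_n)=\infty$ for all $n$. Then $$\inf_{z\in D} \frac{|f_n'|}{1+|f_n|^\alpha}(z)\longrightarrow 0 \qquad (n\to\infty).$$
   Context: A domain is a nonempty connected open subset of $\mathbb{C}$. The condition $f_n(p_n)=\infty$ means that $p_n$ is a pole of $f_n$. At a pole of $f_n$, the value of the quotient $\frac{|f_n'|}{1+|f_n|^\alpha}$ is understood as its limit in $[0,\infty]$. *)

theory Defs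
  imports "HOL-Complex_Analysis.Complex_Analysis"
begin

text \<open>
  Meromorphic functions into the Riemann sphere are represented by functions that are
  \<open>nicely_meromorphic_on\<close> their domain: no removable singularities, the value at a pole is the
  dummy value \<open>0\<close>, and the value infinity at \<open>z\<close> is expressed by \<open>is_pole f z\<close>.  Hence
  \<open>f z = 0\<close> alone does not say that \<open>z\<close> is a zero.
\<close>

definition is_zero_of :: "(complex \<Rightarrow> complex) \<Rightarrow> complex \<Rightarrow> bool" where
  "is_zero_of f z \<longleftrightarrow> \<not> is_pole f z \<and> f z = 0"

definition deriv_quotient_raw :: "real \<Rightarrow> (complex \<Rightarrow> complex) \<Rightarrow> complex \<Rightarrow> ennreal" where
  "deriv_quotient_raw \<alpha> f z = ennreal (norm (deriv f z) / (1 + norm (f z) powr \<alpha>))"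

text \<open>
  At a pole the value is the limit in \<open>[0, \<infinity>]\<close> (which may be \<open>\<infinity>\<close>, e.g. for \<open>\<alpha> = 1\<close>).
\<close>

definition deriv_quotient :: "real \<Rightarrow> (complex \<Rightarrow> complex) \<Rightarrow> complex \<Rightarrow> ennreal" where
  "deriv_quotient \<alpha> f z =
     (if is_pole f z then Lim (at z) (deriv_quotient_raw \<alpha> f) else deriv_quotient_raw \<alpha> f z)"

end

theory Submission imports Defs begin

text \<open>
  Since \<open>\<alpha> \<ge> 1\<close>, a lower bound \<open>c\<close> for the quotient on a disc makes \<open>g = f / f'\<close> holomorphic and
  bounded by \<open>1 / c\<close> there. The derivative of \<open>g\<close> is \<open>1\<close> at a zero of \<open>f\<close> and \<open>- 1 / k\<close> at a pole
  of order \<open>k\<close>, whereas Cauchy's estimate makes \<open>g'\<close> Lipschitz with constant \<open>O(1 / c)\<close> on a smaller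
  disc. Hence \<open>c\<close> is at most a constant times the distance between a zero and a pole.
\<close>

text \<open>The half disc is convex, so a uniform bound on the second derivative there is a
  Lipschitz constant for \<open>deriv g\<close>.\<close>

lemma Cauchy_deriv_Lipschitz:
  fixes g :: "complex \<Rightarrow> complex"
  assumes holo: "g holomorphic_on ball a r" and bound: "\<And>w. w \<in> ball a r \<Longrightarrow> norm (g w) \<le> B"
    and x: "x \<in> ball a (r / 2)" and y: "y \<in> ball a (r / 2)"
  shows "norm (deriv g x - deriv g y) \<le> 32 * B / r\<^sup>2 * norm (x - y)"
proof (rule field_differentiable_bound[where S = "ball a (r / 2)" and f' = "deriv (deriv g)"])
  have r: "0 < r"
    using x by (metis ball_eq_empty empty_iff half_gt_zero_iff not_le)
  fix w assume w: "w \<in> ball a (r / 2)"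
  have sub: "cball w (r / 4) \<subseteq> ball a r"
  proof
    fix v assume "v \<in> cball w (r / 4)"
    then show "v \<in> ball a r"
      using w r dist_triangle[of a v w] by simp
  qed
  have "w \<in> ball a r"
    using w r by simp
  then show "(deriv g has_field_derivative deriv (deriv g) w) (at w within ball a (r / 2))"
    by (meson holo holomorphic_deriv holomorphic_derivI open_ball)
  \<comment> \<open>The disc of radius \<open>r / 4\<close> about a point of the half disc stays
    inside \<open>ball a r\<close>, and 2! * 4^2 = 32.\<close>
  have "norm ((deriv ^^ 2) g w) \<le> fact 2 * B / (r / 4) ^ 2"
  proof (rule Cauchy_inequality)
    show "g holomorphic_on ball w (r / 4)"
      using holo sub ball_subset_cball holomorphic_on_subset by (metis order_trans)
    show "continuous_on (cball w (r / 4)) g"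
      using holo sub holomorphic_on_imp_continuous_on holomorphic_on_subset by blast
    show "0 < r / 4" using r by simp
    show "norm (g v) \<le> B" if "norm (w - v) = r / 4" for v
      using that sub by (intro bound) (auto simp: dist_norm)
  qed
  then show "norm (deriv (deriv g) w) \<le> 32 * B / r\<^sup>2"
    by (simp add: numeral_2_eq_2 power_divide field_simps)
qed (use x y in auto)

text \<open>By the quotient rule the derivative of f/f' is 1 - f f''/f'^2, and the second term
  vanishes where f does.\<close>

lemma deriv_divide_deriv_at_zero:
  assumes "f analytic_on {a}" "f a = 0" "deriv f a \<noteq> 0"
  shows "deriv (\<lambda>w. f w / deriv f w) a = 1"
proof -
  have "(f has_field_derivative deriv f a) (at a)"
    using assms(1) analytic_on_imp_differentiable_at field_differentiable_derivI by blast
  moreover have "(deriv f has_field_derivative deriv (deriv f) a) (at a)"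
    using assms(1) analytic_deriv analytic_on_imp_differentiable_at field_differentiable_derivI
    by blast
  ultimately have "((\<lambda>w. f w / deriv f w) has_field_derivative
      (deriv f a * deriv f a - f a * deriv (deriv f) a) / (deriv f a * deriv f a)) (at a)"
    using assms(3) by (intro DERIV_divide)
  then show ?thesis
    using assms by (simp add: DERIV_imp_deriv)
qed

text \<open>With f = h/(w - p)^k and h(p) nonzero, f/f' equals (w - p) h/((w - p) h' - k h). So f/f'
  has a removable singularity with value 0 at the pole, and the dummy value \<open>f p = 0\<close>
  fills it in correctly.\<close>

lemma divide_deriv_at_pole:
  assumes iso: "isolated_singularity_at f p" and pole: "is_pole f p"
    and zero: "f p = 0"
  obtains m :: nat
  where "(\<lambda>w. f w / deriv f w) analytic_on {p}"
    and "deriv (\<lambda>w. f w / deriv f w) p = - 1 / of_nat (Suc m)"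
proof -
  obtain R where R: "R > 0" "f analytic_on ball p R - {p}"
    using iso unfolding isolated_singularity_at_def by blast
  define h where "h = zor_poly f p"
  obtain r where neg: "zorder f p < 0" and h0: "h p \<noteq> 0" and r: "r > 0"
    and holo: "h holomorphic_on cball p r"
    and eq: "\<And>w. w \<in> cball p r - {p} \<Longrightarrow> f w = h w / (w - p) ^ nat (- zorder f p)"
    using zorder_exist_pole[of f "ball p R" p] R analytic_imp_holomorphic pole
    unfolding h_def by (auto 0 3)
  \<comment> \<open>Writing the order as a successor keeps truncated subtraction out of the power
    rule and makes the order visibly nonzero.\<close>
  obtain m where m: "nat (- zorder f p) = Suc m"
    using neg by (metis gr0_implies_Suc neg_0_less_iff_less zero_less_nat_eq)
  have hb: "h holomorphic_on ball p r"
    using holo ball_subset_cball holomorphic_on_subset by blast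
  define Q where "Q = (\<lambda>w. h w / ((w - p) * deriv h w - of_nat (Suc m) * h w))"
  have quot: "f w / deriv f w = (w - p) * Q w" if w: "w \<in> ball p r" for w
  proof (cases "w = p")
    case True
    then show ?thesis using zero by simp
  next
    case False
    have dh: "(h has_field_derivative deriv h w) (at w)"
      using hb w holomorphic_derivI by blast
    have "((\<lambda>v. (v - p) ^ Suc m) has_field_derivative of_nat (Suc m) * (w - p) ^ m) (at w)"
      by (auto intro!: DERIV_cong[OF DERIV_power] derivative_eq_intros simp del: power_Suc)
    \<comment> \<open>Cancels the common factor \<open>u ^ m\<close> in the quotient rule, with u =
      w - p.\<close>
    moreover have "(A * u ^ Suc m - B * (k * u ^ m)) / (u ^ Suc m * u ^ Suc m)
        = (u * A - k * B) / u ^ Suc (Suc m)" if "u \<noteq> 0" for A B k u :: complex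
      using that by (simp add: divide_simps) (simp add: algebra_simps)
    ultimately have "((\<lambda>v. h v / (v - p) ^ Suc m) has_field_derivative
        ((w - p) * deriv h w - of_nat (Suc m) * h w) / (w - p) ^ Suc (Suc m)) (at w)"
      using False by (intro DERIV_cong[OF DERIV_divide[OF dh]]) auto
    then have "(f has_field_derivative
        ((w - p) * deriv h w - of_nat (Suc m) * h w) / (w - p) ^ Suc (Suc m)) (at w)"
      by (rule has_field_derivative_transform_within_open[where S = "ball p r - {p}"])
        (use w False eq m in auto)
    then have "deriv f w = ((w - p) * deriv h w - of_nat (Suc m) * h w) / (w - p) ^ Suc (Suc m)"
      by (rule DERIV_imp_deriv)
    moreover have "f w = h w / (w - p) ^ Suc m"
      using eq[of w] w False m by simp
    ultimately show ?thesis
      using False by (simp add: Q_def)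
  qed
  have ev: "\<forall>\<^sub>F w in nhds p. f w / deriv f w = (w - p) * Q w"
    using quot r by (intro eventually_nhds_in_open[THEN eventually_mono, of "ball p r"]) auto
  have ha: "h analytic_on {p}"
    using hb r by (meson analytic_at centre_in_ball open_ball)
  have nz: "(p - p) * deriv h p - of_nat (Suc m) * h p \<noteq> 0"
    using h0 by (simp del: of_nat_Suc)
  have Q: "Q analytic_on {p}"
    unfolding Q_def using nz by (intro analytic_intros ha analytic_deriv) auto
  have "(\<lambda>w. (w - p) * Q w) analytic_on {p}"
    by (intro analytic_intros Q)
  then have an: "(\<lambda>w. f w / deriv f w) analytic_on {p}"
    using analytic_at_cong[OF ev refl] by simp
  have "(Q has_field_derivative deriv Q p) (at p)"
    using Q analytic_on_imp_differentiable_at field_differentiable_derivI by blast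
  \<comment> \<open>In the product rule the term with \<open>deriv Q p\<close> carries the factor p
    - p = 0.\<close>
  then have "((\<lambda>w. (w - p) * Q w) has_field_derivative Q p) (at p)"
    by (auto intro!: derivative_eq_intros)
  then have "deriv (\<lambda>w. f w / deriv f w) p = Q p"
    using deriv_cong_ev[OF ev refl] DERIV_imp_deriv by metis
  also have "\<dots> = - 1 / of_nat (Suc m)"
    using h0 by (simp add: Q_def divide_simps del: of_nat_Suc)
  finally show ?thesis
    using an that by blast
qed

text \<open>Here \<alpha> \<ge> 1 enters: it lets the denominator of the quotient dominate |f|, so
  that a lower bound on the quotient bounds f/f'.\<close>

lemma le_one_plus_powr:
  fixes x \<alpha> :: real
  assumes "\<alpha> \<ge> 1" "x \<ge> 0"
  shows "x \<le> 1 + x powr \<alpha>"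
proof (cases "x \<le> 1")
  case True
  then show ?thesis by (simp add: add_increasing2)
next
  case False
  then have "x powr 1 \<le> x powr \<alpha>"
    using assms by (intro powr_mono) auto
  then show ?thesis using False by simp
qed

lemma deriv_lower_bound_zero_pole:
  fixes f :: "complex \<Rightarrow> complex"
  assumes \<alpha>: "\<alpha> \<ge> 1" and c: "c > 0" and f: "f nicely_meromorphic_on ball a r"
    and low: "\<And>w. w \<in> ball a r \<Longrightarrow> \<not> is_pole f w \<Longrightarrow> c * (1 + norm (f w) powr \<alpha>) \<le> norm (deriv f w)"
    and z: "z \<in> ball a (r / 2)" "is_zero_of f z"
    and p: "p \<in> ball a (r / 2)" "is_pole f p"
  shows "c \<le> 32 / r\<^sup>2 * norm (z - p)"
proof -
  define g where "g = (\<lambda>w. f w / deriv f w)"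
  have r: "0 < r"
    using z(1) by (metis ball_eq_empty empty_iff half_gt_zero_iff not_le)
  \<comment> \<open>Nice meromorphy offers the dummy value 0 or convergence to \<open>f w\<close>; a
    pole excludes the latter.\<close>
  have pole0: "f w = 0" if "w \<in> ball a r" "is_pole f w" for w
    using f that not_tendsto_and_filterlim_at_infinity[of "at w" f "f w"]
    unfolding nicely_meromorphic_on_def is_pole_def by auto
  have an: "f analytic_on {w}" if "w \<in> ball a r" "\<not> is_pole f w" for w
    using f that nicely_meromorphic_on_imp_analytic_at by blast
  \<comment> \<open>The lower bound rules out critical points, so f/f' has no singularities off the
    poles of f.\<close>
  have nz: "deriv f w \<noteq> 0" if "w \<in> ball a r" "\<not> is_pole f w" for w
  proof -
    have "0 < c * (1 + norm (f w) powr \<alpha>)"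
      using c by (simp add: add_pos_nonneg)
    then show ?thesis using low[OF that] by auto
  qed
  have at_pole: "g analytic_on {w} \<and> (\<exists>m. deriv g w = - 1 / of_nat (Suc m))"
    if "w \<in> ball a r" "is_pole f w" for w
  proof -
    have "f meromorphic_on {w}"
      using f that meromorphic_on_subset unfolding nicely_meromorphic_on_def by blast
    then show ?thesis
      using divide_deriv_at_pole[of f w] pole0 that unfolding g_def meromorphic_at_iff by metis
  qed
  have "g analytic_on {w}" if "w \<in> ball a r" for w
  proof (cases "is_pole f w")
    case True
    then show ?thesis using at_pole that by blast
  next
    case False
    then show ?thesis
      unfolding g_def using that nz an by (intro analytic_intros analytic_deriv) auto
  qed
  then have holo: "g holomorphic_on ball a r"
    by (meson analytic_imp_holomorphic analytic_on_analytic_at)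
  have bound: "norm (g w) \<le> 1 / c" if w: "w \<in> ball a r" for w
  proof (cases "is_pole f w")
    case True
    then show ?thesis using pole0 w c by (simp add: g_def)
  next
    case False
    have "c * norm (f w) \<le> c * (1 + norm (f w) powr \<alpha>)"
      using c \<alpha> by (intro mult_left_mono le_one_plus_powr) auto
    also have "\<dots> \<le> norm (deriv f w)"
      using low w False by blast
    finally show ?thesis
      using nz[OF w False] c by (simp add: g_def norm_divide field_simps)
  qed
  have half: "ball a (r / 2) \<subseteq> ball a r"
    using r by auto
  have "deriv g z = 1"
    unfolding g_def
    using z half an nz by (intro deriv_divide_deriv_at_zero) (auto simp: is_zero_of_def)
  moreover obtain m where m: "deriv g p = - 1 / of_nat (Suc m)"
    using at_pole p half by blast
  \<comment> \<open>The two derivatives have opposite signs, so their gap is at least 1 whatever the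
    order of the pole.\<close>
  ultimately have "deriv g z - deriv g p = of_real (1 + 1 / real (Suc m))"
    by simp
  then have "norm (deriv g z - deriv g p) = \<bar>1 + 1 / real (Suc m)\<bar>"
    by (simp only: norm_of_real)
  then have "1 \<le> norm (deriv g z - deriv g p)"
    by simp
  also have "\<dots> \<le> 32 * (1 / c) / r\<^sup>2 * norm (z - p)"
    by (rule Cauchy_deriv_Lipschitz[OF holo bound z(1) p(1)])
  finally show ?thesis
    using c r by (simp add: field_simps)
qed

text \<open>The infimum itself serves as the lower bound \<open>c\<close> of the preceding lemma.
  That lemma needs \<open>c\<close> real and positive, so the values 0 and \<infinity> are treated
  apart.\<close>

lemma INF_deriv_quotient_le:
  assumes \<alpha>: "\<alpha> \<ge> 1" and f: "f nicely_meromorphic_on D" and D: "ball a r \<subseteq> D"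
    and z: "z \<in> ball a (r / 2)" "is_zero_of f z"
    and p: "p \<in> ball a (r / 2)" "is_pole f p"
  shows "(INF w\<in>D. deriv_quotient \<alpha> f w) \<le> ennreal (32 / r\<^sup>2 * norm (z - p))"
    (is "?I \<le> _")
proof (cases ?I)
  case (real c)
  show ?thesis
  proof (cases "c = 0")
    case True
    then show ?thesis using real by simp
  next
    case False
    \<comment> \<open>Away from the poles \<open>deriv_quotient\<close> is the raw quotient, so the
      denominator can be cleared.\<close>
    have "c * (1 + norm (f w) powr \<alpha>) \<le> norm (deriv f w)"
      if w: "w \<in> ball a r" "\<not> is_pole f w" for w
    proof -
      have "ennreal c \<le> deriv_quotient \<alpha> f w"
        unfolding real(2)[symmetric] using w D by (intro INF_lower) auto
      then have "c \<le> norm (deriv f w) / (1 + norm (f w) powr \<alpha>)"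
        using w(2) by (simp add: deriv_quotient_def deriv_quotient_raw_def)
      moreover have "0 < 1 + norm (f w) powr \<alpha>"
        by (simp add: add_pos_nonneg)
      ultimately show ?thesis
        by (simp add: pos_le_divide_eq)
    qed
    then have "c \<le> 32 / r\<^sup>2 * norm (z - p)"
      using False real(1) f D z p \<alpha>
      by (intro deriv_lower_bound_zero_pole[of \<alpha> c f a r])
        (auto intro: nicely_meromorphic_on_subset)
    then show ?thesis
      using real by (simp add: ennreal_leI)
  qed
next
  \<comment> \<open>The infimum is finite because the zero \<open>z\<close> is not a pole, so the
    quotient there is a real number.\<close>
  case top
  have "0 < r"
    using z(1) by (metis ball_eq_empty empty_iff half_gt_zero_iff not_le)
  then have "z \<in> D"
    using z(1) D by auto
  then have "?I \<le> deriv_quotient \<alpha> f z"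
    by (rule INF_lower)
  also have "\<dots> < top"
    using z(2) by (simp add: deriv_quotient_def deriv_quotient_raw_def is_zero_of_def)
  finally show ?thesis using top by simp
qed

theorem theorem2:
  fixes \<alpha> :: real
    and D :: "complex set"
    and f :: "nat \<Rightarrow> complex \<Rightarrow> complex"
    and z0 :: complex
    and z p :: "nat \<Rightarrow> complex"
  assumes "\<alpha> \<ge> 1"
    and "open D" and "connected D"
    and "\<And>n. f n nicely_meromorphic_on D"
    and "z0 \<in> D"
    and "\<And>n. z n \<in> D" and "\<And>n. p n \<in> D"
    and "z \<longlonglongrightarrow> z0" and "p \<longlonglongrightarrow> z0"
    and "\<And>n. is_zero_of (f n) (z n)"
    and "\<And>n. is_pole (f n) (p n)"
  shows "(\<lambda>n. INF w\<in>D. deriv_quotient \<alpha> (f n) w) \<longlonglongrightarrow> 0"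
proof -
  obtain r where r: "r > 0" "ball z0 r \<subseteq> D"
    using assms(2,5) open_contains_ball by blast
  have ball: "z0 \<in> ball z0 (r / 2)"
    using r by simp
  have "\<forall>\<^sub>F n in sequentially. z n \<in> ball z0 (r / 2)"
    using assms(8) open_ball ball by (rule topological_tendstoD)
  moreover have "\<forall>\<^sub>F n in sequentially. p n \<in> ball z0 (r / 2)"
    using assms(9) open_ball ball by (rule topological_tendstoD)
  \<comment> \<open>The factor \<open>32 / r\<^sup>2\<close> depends only on the disc about
    \<open>z0\<close>, not on n, so the bound tends to 0 with the distance between
    \<open>z n\<close> and \<open>p n\<close>.\<close>
  ultimately have upper: "\<forall>\<^sub>F n in sequentially.
      (INF w\<in>D. deriv_quotient \<alpha> (f n) w) \<le> ennreal (32 / r\<^sup>2 * norm (z n - p n))"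
    by eventually_elim (intro INF_deriv_quotient_le[OF assms(1,4) r(2)] assms)
  have "(\<lambda>n. 32 / r\<^sup>2 * norm (z n - p n)) \<longlonglongrightarrow> 32 / r\<^sup>2 * norm (z0 - z0)"
    by (intro tendsto_intros assms)
  then have "(\<lambda>n. ennreal (32 / r\<^sup>2 * norm (z n - p n))) \<longlonglongrightarrow> ennreal (32 / r\<^sup>2 * norm (z0 - z0))"
    by (rule tendsto_ennrealI)
  then have "(\<lambda>n. ennreal (32 / r\<^sup>2 * norm (z n - p n))) \<longlonglongrightarrow> 0"
    by simp
  then show ?thesis
    by (rule tendsto_sandwich[OF _ upper tendsto_const, rotated]) simp
qed

end
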